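(* Let $p$ be a complex number, and let $\{u_k\}$ and $\{v_k\}$ be the generalized Fibonacci and Lucas sequences with parameter $p$. Then for every integer $n\ge 0$ and every integer $r\ge 1$, $$\sum_{k=0}^{n}\binom{2n}{n+k}v_{k}^{2r}=\begin{cases}\displaystyle \binom{2r}{r}2^{2n-1}+2^{2r-1}\binom{2n}{n}+\sum_{i=0}^{r-1}(-1)^{in}\binom{2r}{i}v_{r-i}^{2n} & \text{if } r \text{ is even},\\[3ex] \displaystyle 2^{2r-1}\binom{2n}{n}+(p^{2}+4)^{n}\left(\sum_{i=0}^{r-1}(-1)^{in}\binom{2r}{i}u_{r-i}^{2n}\right) & \text{if } r \text{ is odd}.\end{cases}$$
   Context: For a complex number $p$, the sequences $\{u_k\}_{k\ge 0}$ and $\{v_k\}_{k\ge 0}$ of complex numbers are defined by $u_0=0$, $u_1=1$, $u_{k+1}=p\,u_k+u_{k-1}$ for $k\ge 1$, and $v_0=2$, $v_1=p$, $v_{k+1}=p\,v_k+v_{k-1}$ for $k\ge 1$.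
   Formalization: For odd r the identity is stated only for n ≥ 1, since at n = 0 with r odd it is false: for n = 0, r = 1 the left side is 4 and the right side is 3; for even r, n = 0 is included. *)

theory Defs
  imports Complex_Main
begin

fun gen_fib :: "complex \<Rightarrow> nat \<Rightarrow> complex" where
  "gen_fib p 0 = 0"
| "gen_fib p (Suc 0) = 1"
| "gen_fib p (Suc (Suc k)) = p * gen_fib p (Suc k) + gen_fib p k"

fun gen_lucas :: "complex \<Rightarrow> nat \<Rightarrow> complex" where
  "gen_lucas p 0 = 2"
| "gen_lucas p (Suc 0) = p"
| "gen_lucas p (Suc (Suc k)) = p * gen_lucas p (Suc k) + gen_lucas p k"

text \<open>
  The identity for odd \<open>r\<close> does not extend to \<open>n = 0\<close>: its proof uses that the alternating sum of
  the binomial coefficients \<open>2 * n choose k\<close> vanishes, which is false for \<open>n = 0\<close>. For \<open>r = 1\<close>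
  the two sides are 4 and 3, whatever \<open>p\<close> is. For even \<open>r\<close>, \<open>n = 0\<close> is unproblematic.
\<close>

lemma odd_case_fails_at_0:
  fixes p :: complex and n r :: nat
  assumes "n = 0" and "r = 1"
  shows "(\<Sum>k=0..n. of_nat ((2 * n) choose (n + k)) * gen_lucas p k ^ (2 * r))
    \<noteq> 2 ^ (2 * r - 1) * of_nat ((2 * n) choose n)
      + (p\<^sup>2 + 4) ^ n *
        (\<Sum>i=0..r - 1. (- 1) ^ (i * n) * of_nat ((2 * r) choose i) * gen_fib p (r - i) ^ (2 * n))"
  using assms by simp

end

theory Submission
  imports Defs
begin

text \<open>
  Let \<open>a\<close>, \<open>b\<close> be the roots of \<open>x\<^sup>2 = p * x + 1\<close>, so that \<open>a * b = - 1\<close>, and extend the Lucas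
  sequence to negative indices by the Binet formula \<open>v k = a ^ k + b ^ k\<close>. As \<open>v (- k)\<close> is
  \<open>v k\<close> up to sign, twice the sum in question is the sum over \<open>- n \<le> k \<le> n\<close> plus the term at
  \<open>k = 0\<close>. In the full sum one expands \<open>v k ^ (2 * r)\<close> by the binomial theorem and exchanges the
  two summations; the sum over \<open>k\<close> of the \<open>i\<close>-th term is then itself a binomial expansion, of the
  \<open>n\<close>-th power of \<open>(1 + x)\<^sup>2 / x\<close> with \<open>x = a ^ i * b ^ (2 * r - i)\<close>
  (\<open>sum_binomial_shifted_power\<close>).

  Because \<open>a * b = - 1\<close>, that fraction equals \<open>(- 1) ^ i * (a ^ m + (- 1) ^ r * b ^ m)\<^sup>2\<close> with
  \<open>m = r - i\<close> if \<open>i \<le> r\<close> (\<open>binomial_term_square\<close>). For even \<open>r\<close> the square is that of a Lucas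
  number; for odd \<open>r\<close> it is that of \<open>a ^ m - b ^ m = (a - b) * u m\<close>, where
  \<open>(a - b)\<^sup>2 = p\<^sup>2 + 4\<close>. The terms \<open>i\<close> and \<open>2 * r - i\<close> agree, which leaves twice the sum over
  \<open>i < r\<close> plus the middle term \<open>i = r\<close>. The middle term is \<open>(2 * r choose r) * 4 ^ n\<close> for even
  \<open>r\<close>, and a multiple of \<open>0 ^ n\<close> for odd \<open>r\<close>: this is where \<open>n \<ge> 1\<close> enters.

  Negative powers are avoided by multiplying \<open>v (j - n)\<close> by \<open>(a * b) ^ n = (- 1) ^ n\<close>, which gives
  the polynomial \<open>a ^ j * b ^ n + b ^ j * a ^ n\<close> and does not affect even powers.
\<close>

lemma characteristic_roots_exist:
  fixes p :: complex
  obtains a b :: complex where "a + b = p" "a * b = - 1"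
proof -
  define s where "s = csqrt (p\<^sup>2 + 4)"
  have "s * s = p\<^sup>2 + 4"
    unfolding s_def by (metis power2_csqrt power2_eq_square)
  then have "(p + s) / 2 * ((p - s) / 2) = - 1"
    by (simp add: field_simps power2_eq_square)
  moreover have "(p + s) / 2 + (p - s) / 2 = p"
    by (simp add: field_simps)
  ultimately show thesis
    using that by blast
qed

lemma power_Suc_Suc_characteristic_root:
  fixes a b :: "'a::comm_ring_1"
  assumes "a * b = - 1"
  shows "a ^ Suc (Suc k) = (a + b) * a ^ Suc k + a ^ k"
proof -
  have "(a + b) * a ^ Suc k = a ^ Suc (Suc k) + (a * b) * a ^ k"
    by (simp add: algebra_simps)
  then show ?thesis
    using assms by simp
qed

lemma gen_lucas_Binet:
  fixes a b :: complex
  assumes "a * b = - 1"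
  shows "gen_lucas (a + b) k = a ^ k + b ^ k"
proof (induction k rule: induct_nat_012)
  case (ge2 k)
  have "b ^ Suc (Suc k) = (a + b) * b ^ Suc k + b ^ k"
    using power_Suc_Suc_characteristic_root[of b a k] assms by (simp add: ac_simps)
  with power_Suc_Suc_characteristic_root[OF assms, of k] ge2 show ?case
    by (simp add: distrib_left del: power_Suc)
qed auto

text \<open>Stated without division by \<open>a - b\<close>, so that it includes the case of a double root.\<close>

lemma gen_fib_Binet:
  fixes a b :: complex
  assumes "a * b = - 1"
  shows "(a - b) * gen_fib (a + b) k = a ^ k - b ^ k"
proof (induction k rule: induct_nat_012)
  case (ge2 k)
  have "b ^ Suc (Suc k) = (a + b) * b ^ Suc k + b ^ k"
    using power_Suc_Suc_characteristic_root[of b a k] assms by (simp add: ac_simps)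
  moreover have "(a - b) * gen_fib (a + b) (Suc (Suc k)) =
      (a + b) * ((a - b) * gen_fib (a + b) (Suc k)) + (a - b) * gen_fib (a + b) k"
    by (simp add: algebra_simps)
  ultimately show ?case
    using power_Suc_Suc_characteristic_root[OF assms, of k] ge2
    by (simp add: right_diff_distrib del: power_Suc gen_fib.simps)
qed auto

text \<open>
  Used twice: for the sum over the index of the Lucas numbers, and for the sum that comes from the
  binomial expansion of their powers.
\<close>

lemma sum_palindromic:
  fixes f :: "nat \<Rightarrow> 'a::comm_semiring_1"
  assumes "\<And>i. i \<le> n \<Longrightarrow> f (2 * n - i) = f i"
  shows "(\<Sum>i\<le>2 * n. f i) = 2 * (\<Sum>i<n. f i) + f n"
proof -
  have "{..2 * n} = {..<n} \<union> {n} \<union> {n<..2 * n}"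
    by auto
  then have "(\<Sum>i\<le>2 * n. f i) = (\<Sum>i\<in>{..<n} \<union> {n}. f i) + (\<Sum>i\<in>{n<..2 * n}. f i)"
    by (simp only:) (rule sum.union_disjoint, auto)
  also have "(\<Sum>i\<in>{..<n} \<union> {n}. f i) = (\<Sum>i<n. f i) + f n"
    by (subst sum.union_disjoint) auto
  also have "(\<Sum>i\<in>{n<..2 * n}. f i) = (\<Sum>i<n. f i)"
    by (rule sum.reindex_bij_witness[of _ "\<lambda>i. 2 * n - i" "\<lambda>i. 2 * n - i"])
      (use assms in \<open>auto simp: assms[symmetric]\<close>)
  finally show ?thesis
    by (simp add: algebra_simps mult_2)
qed

text \<open>
  The inner sums of the double sum are binomial expansions of \<open>(1 + a ^ i * b ^ (N - i)) ^ (2 * n)\<close>.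
\<close>

lemma sum_binomial_shifted_power:
  fixes a b :: "'a::comm_ring_1"
  shows "(\<Sum>j\<le>2 * n. of_nat ((2 * n) choose j) * (a ^ j * b ^ n + b ^ j * a ^ n) ^ N) =
    (\<Sum>i\<le>N. of_nat (N choose i) *
      (b ^ i * a ^ (N - i) * (1 + a ^ i * b ^ (N - i))\<^sup>2) ^ n)"
proof -
  have "(\<Sum>j\<le>2 * n. of_nat ((2 * n) choose j) * (a ^ j * b ^ n + b ^ j * a ^ n) ^ N) =
      (\<Sum>j\<le>2 * n. \<Sum>i\<le>N. of_nat (N choose i) * (b ^ i * a ^ (N - i)) ^ n *
        (of_nat ((2 * n) choose j) * (a ^ i * b ^ (N - i)) ^ j))"
    by (simp add: binomial_ring sum_distrib_left power_mult_distrib mult_ac flip: power_mult)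
  also have "\<dots> = (\<Sum>i\<le>N. of_nat (N choose i) * (b ^ i * a ^ (N - i)) ^ n *
      (\<Sum>j\<le>2 * n. of_nat ((2 * n) choose j) * (a ^ i * b ^ (N - i)) ^ j))"
    by (subst sum.swap) (simp add: sum_distrib_left)
  also have "\<dots> = (\<Sum>i\<le>N. of_nat (N choose i) * (b ^ i * a ^ (N - i)) ^ n *
      (1 + a ^ i * b ^ (N - i)) ^ (2 * n))"
    using binomial_ring[of "a ^ i * b ^ (N - i)" 1 "2 * n" for i]
    by (simp add: add.commute)
  finally show ?thesis
    by (simp add: power_mult power_mult_distrib mult.assoc)
qed

text \<open>
  Of the \<open>2 * r\<close> factors, \<open>i\<close> pairs \<open>a * b\<close> cancel to the sign \<open>(- 1) ^ i\<close>; what remains of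
  \<open>a ^ (2 * m)\<close> is absorbed into the square, where \<open>a ^ m * b ^ (2 * m) = (- 1) ^ m * b ^ m\<close>.
\<close>

lemma binomial_term_square:
  fixes a b :: "'a::comm_ring_1"
  assumes ab: "a * b = - 1" and "i \<le> r"
  shows "b ^ i * a ^ (2 * r - i) * (1 + a ^ i * b ^ (2 * r - i))\<^sup>2 =
    (- 1) ^ i * (a ^ (r - i) + (- 1) ^ r * b ^ (r - i))\<^sup>2"
proof -
  define m where "m = r - i"
  have r: "r = i + m" and ri: "2 * r - i = i + m + m"
    using \<open>i \<le> r\<close> by (auto simp: m_def)
  have sign: "a ^ k * b ^ k = (- 1) ^ k" for k
    by (simp add: ab flip: power_mult_distrib)
  have "b ^ i * a ^ (2 * r - i) * (1 + a ^ i * b ^ (2 * r - i))\<^sup>2 =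
      (a ^ i * b ^ i) * (a ^ m + (a ^ i * b ^ i) * (a ^ m * b ^ m) * b ^ m)\<^sup>2"
    unfolding ri by (simp add: power_add power2_eq_square algebra_simps)
  then show ?thesis
    by (simp add: sign r power_add)
qed

lemma sum_binomial_shifted_power_reduced:
  fixes a b :: "'a::comm_ring_1"
  assumes ab: "a * b = - 1"
  shows "(\<Sum>j\<le>2 * n. of_nat ((2 * n) choose j) * (a ^ j * b ^ n + b ^ j * a ^ n) ^ (2 * r)) =
    2 * (\<Sum>i<r. (- 1) ^ (i * n) * of_nat ((2 * r) choose i) *
      (a ^ (r - i) + (- 1) ^ r * b ^ (r - i)) ^ (2 * n))
    + of_nat ((2 * r) choose r) * ((- 1) ^ r * (1 + (- 1) ^ r)\<^sup>2) ^ n"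
proof -
  define f where "f i = of_nat ((2 * r) choose i) *
    (b ^ i * a ^ (2 * r - i) * (1 + a ^ i * b ^ (2 * r - i))\<^sup>2) ^ n" for i
  have f: "f i = of_nat ((2 * r) choose i) *
      ((- 1) ^ i * (a ^ (r - i) + (- 1) ^ r * b ^ (r - i))\<^sup>2) ^ n" if "i \<le> r" for i
    using binomial_term_square[OF ab that] by (simp add: f_def)
  have "f (2 * r - i) = f i" if "i \<le> r" for i
  proof -
    (* Replacing i by 2 * r - i amounts to exchanging a and b, which changes
       a ^ m + (- 1) ^ r * b ^ m at most by a sign. *)
    have "f (2 * r - i) = of_nat ((2 * r) choose i) *
        (a ^ i * b ^ (2 * r - i) * (1 + b ^ i * a ^ (2 * r - i))\<^sup>2) ^ n"
      using that binomial_symmetric[of i "2 * r"] by (simp add: f_def mult.commute)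
    also have "\<dots> = of_nat ((2 * r) choose i) *
        ((- 1) ^ i * (b ^ (r - i) + (- 1) ^ r * a ^ (r - i))\<^sup>2) ^ n"
      using binomial_term_square[of b a i r] ab that by (simp add: mult.commute)
    also have "(b ^ (r - i) + (- 1) ^ r * a ^ (r - i))\<^sup>2 =
        (a ^ (r - i) + (- 1) ^ r * b ^ (r - i))\<^sup>2"
      by (cases "even r") (simp_all add: add.commute power2_commute)
    finally show ?thesis
      using f[OF that] by simp
  qed
  then have "(\<Sum>i\<le>2 * r. f i) = 2 * (\<Sum>i<r. f i) + f r"
    by (rule sum_palindromic)
  moreover have "f r = of_nat ((2 * r) choose r) * ((- 1) ^ r * (1 + (- 1) ^ r)\<^sup>2) ^ n"
    by (simp add: f)
  moreover have "(\<Sum>i<r. f i) = (\<Sum>i<r. (- 1) ^ (i * n) * of_nat ((2 * r) choose i) *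
      (a ^ (r - i) + (- 1) ^ r * b ^ (r - i)) ^ (2 * n))"
    by (intro sum.cong) (simp_all add: f power_mult_distrib mult_ac flip: power_mult)
  ultimately show ?thesis
    by (simp add: sum_binomial_shifted_power f_def)
qed

text \<open>
  Up to sign, \<open>a ^ j * b ^ n + b ^ j * a ^ n\<close> is \<open>v \<bar>j - n\<bar>\<close>, so the sum over all \<open>j\<close> is
  palindromic and counts every index of the sum on the left twice, except \<open>k = 0\<close>.
\<close>

lemma double_sum_gen_lucas_power:
  fixes a b :: complex
  assumes ab: "a * b = - 1"
  shows "2 * (\<Sum>k=0..n. of_nat ((2 * n) choose (n + k)) * gen_lucas (a + b) k ^ (2 * r)) =
    (\<Sum>j\<le>2 * n. of_nat ((2 * n) choose j) * (a ^ j * b ^ n + b ^ j * a ^ n) ^ (2 * r))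
    + 2 ^ (2 * r) * of_nat ((2 * n) choose n)"
proof -
  define f where "f j = of_nat ((2 * n) choose j) * (a ^ j * b ^ n + b ^ j * a ^ n) ^ (2 * r)" for j
  have sign: "(a ^ k * b ^ k) ^ (2 * r) = 1" for k
    by (simp add: ab flip: power_mult_distrib power_mult)
  have up: "f (n + k) = of_nat ((2 * n) choose (n + k)) * gen_lucas (a + b) k ^ (2 * r)" for k
  proof -
    have "a ^ (n + k) * b ^ n + b ^ (n + k) * a ^ n = (a ^ n * b ^ n) * (a ^ k + b ^ k)"
      by (simp add: power_add algebra_simps)
    then show ?thesis
      by (simp only: f_def gen_lucas_Binet[OF ab] power_mult_distrib[of "a ^ n * b ^ n"] sign) simp
  qed
  have down: "f (n - k) = of_nat ((2 * n) choose (n + k)) * gen_lucas (a + b) k ^ (2 * r)"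
    if k: "k \<le> n" for k
  proof -
    obtain d where n: "n = d + k"
      using k by (metis le_add_diff_inverse2)
    have "a ^ (n - k) * b ^ n + b ^ (n - k) * a ^ n = (a ^ d * b ^ d) * (a ^ k + b ^ k)"
      by (simp add: n power_add algebra_simps)
    moreover have "2 * n - (n - k) = n + k"
      using k by simp
    then have "(2 * n) choose (n - k) = (2 * n) choose (n + k)"
      using binomial_symmetric[of "n - k" "2 * n"] by simp
    ultimately show ?thesis
      by (simp only: f_def gen_lucas_Binet[OF ab] power_mult_distrib[of "a ^ d * b ^ d"] sign) simp
  qed
  have "(\<Sum>j\<le>2 * n. f j) = 2 * (\<Sum>j<n. f j) + f n"
  proof (rule sum_palindromic)
    fix j assume "j \<le> n"
    then show "f (2 * n - j) = f j"
      using up[of "n - j"] down[of "n - j"] by (simp add: mult_2)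
  qed
  moreover have "(\<Sum>k=0..n. of_nat ((2 * n) choose (n + k)) * gen_lucas (a + b) k ^ (2 * r)) =
      (\<Sum>j\<le>n. f j)"
    by (rule sum.reindex_bij_witness[of _ "\<lambda>j. n - j" "\<lambda>k. n - k"]) (auto simp: down)
  moreover have "(\<Sum>j\<le>n. f j) = (\<Sum>j<n. f j) + f n"
    by (simp flip: lessThan_Suc_atMost)
  moreover have "f n = 2 ^ (2 * r) * of_nat ((2 * n) choose n)"
    using up[of 0] by simp
  ultimately show ?thesis
    by (simp add: f_def algebra_simps)
qed

theorem theorem3p2:
  fixes p :: complex and n r :: nat
  assumes "r \<ge> 1"
    and "even r \<or> n \<ge> 1"
  shows "(\<Sum>k=0..n. of_nat ((2 * n) choose (n + k)) * gen_lucas p k ^ (2 * r)) =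
    (if even r then
       of_nat ((2 * r) choose r) * 2 powi (2 * int n - 1)
       + 2 ^ (2 * r - 1) * of_nat ((2 * n) choose n)
       + (\<Sum>i=0..r - 1. (- 1) ^ (i * n) * of_nat ((2 * r) choose i) * gen_lucas p (r - i) ^ (2 * n))
     else
       2 ^ (2 * r - 1) * of_nat ((2 * n) choose n)
       + (p\<^sup>2 + 4) ^ n *
         (\<Sum>i=0..r - 1. (- 1) ^ (i * n) * of_nat ((2 * r) choose i) * gen_fib p (r - i) ^ (2 * n)))"
proof -
  obtain a b where p: "a + b = p" and ab: "a * b = - 1"
    by (rule characteristic_roots_exist)
  define L where "L = (\<Sum>k=0..n. of_nat ((2 * n) choose (n + k)) * gen_lucas p k ^ (2 * r))"
  define S where "S = (\<Sum>i=0..r - 1. (- 1) ^ (i * n) * of_nat ((2 * r) choose i) *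
    (a ^ (r - i) + (- 1) ^ r * b ^ (r - i)) ^ (2 * n))"
  have "{..<r} = {0..r - 1}"
    using assms(1) by auto
  then have main: "2 * L = 2 * S
      + of_nat ((2 * r) choose r) * ((- 1) ^ r * (1 + (- 1) ^ r)\<^sup>2) ^ n
      + 2 ^ (2 * r) * of_nat ((2 * n) choose n)"
    using double_sum_gen_lucas_power[OF ab, of n r] sum_binomial_shifted_power_reduced[OF ab, of n r]
    by (simp add: p L_def S_def)
  have half: "(2::complex) ^ (2 * r) = 2 * 2 ^ (2 * r - 1)"
    using assms(1) by (simp flip: power_Suc)
  show ?thesis
  proof (cases "even r")
    case True
    have "(2::complex) powi (2 * int n - 1) = 4 ^ n / 2"
      by (simp add: power_int_diff power_int_mult)
    moreover have "S = (\<Sum>i=0..r - 1. (- 1) ^ (i * n) * of_nat ((2 * r) choose i) *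
        gen_lucas p (r - i) ^ (2 * n))"
      using True by (simp add: S_def gen_lucas_Binet[OF ab] flip: p)
    moreover have "(- 1 :: complex) ^ r * (1 + (- 1) ^ r)\<^sup>2 = 4"
      using True by simp
    ultimately have "2 * L = 2 * (of_nat ((2 * r) choose r) * 2 powi (2 * int n - 1)
        + 2 ^ (2 * r - 1) * of_nat ((2 * n) choose n)
        + (\<Sum>i=0..r - 1. (- 1) ^ (i * n) * of_nat ((2 * r) choose i) *
            gen_lucas p (r - i) ^ (2 * n)))"
      using main by (simp only: half) (simp add: algebra_simps)
    then show ?thesis
      unfolding L_def[symmetric] using True by (simp del: distrib_left_numeral)
  next
    case False
    then have "n \<ge> 1"
      using assms(2) by simp
    have "(a - b)\<^sup>2 = (a + b)\<^sup>2 - 4 * (a * b)"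
      by (simp add: power2_eq_square algebra_simps)
    then have discriminant: "(a - b)\<^sup>2 = p\<^sup>2 + 4"
      by (simp add: p ab)
    have "(a ^ m - b ^ m) ^ (2 * n) = (p\<^sup>2 + 4) ^ n * gen_fib p m ^ (2 * n)" for m
      using gen_fib_Binet[OF ab, of m]
      by (metis discriminant p power_mult power_mult_distrib)
    then have "S = (p\<^sup>2 + 4) ^ n *
        (\<Sum>i=0..r - 1. (- 1) ^ (i * n) * of_nat ((2 * r) choose i) * gen_fib p (r - i) ^ (2 * n))"
      using False by (simp add: S_def sum_distrib_left mult_ac)
    moreover have "((- 1 :: complex) ^ r * (1 + (- 1) ^ r)\<^sup>2) ^ n = 0"
      using False \<open>n \<ge> 1\<close> by simp
    ultimately have "2 * L = 2 * (2 ^ (2 * r - 1) * of_nat ((2 * n) choose n) + (p\<^sup>2 + 4) ^ n *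
        (\<Sum>i=0..r - 1. (- 1) ^ (i * n) * of_nat ((2 * r) choose i) * gen_fib p (r - i) ^ (2 * n)))"
      using main by (simp only: half) (simp add: algebra_simps)
    then show ?thesis
      unfolding L_def[symmetric] using False by (simp del: distrib_left_numeral)
  qed
qed

end
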